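(* Let $v\geq 2$, $q\geq 2$, $s\geq 3$ and $k\geq 1$ be positive integers. (1) For every $j=0,\ldots,s$, $$K_{vq}^{\mathcal{R}}(2k+1,s,(k+1)s-j)\leq OCAN(ks+j,2k+1,s,v)\cdot \left[q^{ks+j}-q^{k(s-2)+j}(q^{k}-1)\right].$$ (2) $$K_{vq}^{\mathcal{R}}(2k,s,ks)\leq OCAN(ks,2k,s,v) \cdot \left[q^{ks}-q^{k(s-2)}(q^{k}-1)\right].$$
   Context: NRT poset: for positive integers $m,s$, the NRT poset $[m\cdot s]$ is the set $\{1,\ldots,ms\}$ partitioned into $m$ blocks $B_i=\{is+1,\ldots,(i+1)s\}$, $i=0,\ldots,m-1$, where each block is a chain $is+1\preceq is+2\preceq\cdots\preceq (i+1)s$ and elements of different blocks are incomparable. An ideal is a subset $I$ such that $b\in I$ and $a\preceq b$ imply $a\in I$; an anti-ideal is the complement of an ideal; $\langle A\rangle$ denotes the smallest ideal containing $A$. NRT distance: for $x,y\in\mathbb{Z}_q^{ms}$, $d_{\mathcal{R}}(x,y)=|\langle\{i: x_i\neq y_i\}\rangle|$, the ideal being taken in $[m\cdot s]$. Covering codes: a subset $C\subseteq \mathbb{Z}_q^{ms}$ is an $R$-covering of the NRT space $\mathbb{Z}_q^{ms}$ if for every $x\in\mathbb{Z}_q^{ms}$ there is $c\in C$ with $d_{\mathcal{R}}(x,c)\leq R$. $K_q^{\mathcal{R}}(m,s,R)$ is the smallest cardinality of an $R$-covering of the NRT space $\mathbb{Z}_q^{ms}$ (and $K_{vq}^{\mathcal{R}}$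 is the same with alphabet $\mathbb{Z}_{vq}$). Ordered covering arrays: given an $N\times n$ array over an alphabet $V$ of size $v$, a set of $t$ columns is covered if every $t$-tuple over $V$ occurs at least once as a row of the $N\times t$ subarray formed by those columns. For $2\le t\le ms$, an $OCA(N;t,m,s,v)$ is an $N\times ms$ array with entries from an alphabet of size $v$, with columns labeled by $[m\cdot s]$, such that for every anti-ideal $J$ of $[m\cdot s]$ with $|J|=t$ the set of columns labeled by $J$ is covered. $OCAN(t,m,s,v)$ is the smallest positive integer $N$ such that an $OCA(N;t,m,s,v)$ exists. *)

theory Defs
  imports Complex_Main "HOL-Library.FuncSet"
begin

definition nrt_block :: "nat \<Rightarrow> nat \<Rightarrow> nat set" where
  "nrt_block s i = {i * s + 1..(i + 1) * s}"

definition nrt_le :: "nat \<Rightarrow> nat \<Rightarrow> nat \<Rightarrow> nat \<Rightarrow> bool" where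
  "nrt_le m s a b \<longleftrightarrow> (\<exists>i<m. a \<in> nrt_block s i \<and> b \<in> nrt_block s i \<and> a \<le> b)"

definition nrt_ideal :: "nat \<Rightarrow> nat \<Rightarrow> nat set \<Rightarrow> bool" where
  "nrt_ideal m s I \<longleftrightarrow>
     I \<subseteq> {1..m * s} \<and> (\<forall>a b. b \<in> I \<longrightarrow> nrt_le m s a b \<longrightarrow> a \<in> I)"

definition nrt_anti_ideal :: "nat \<Rightarrow> nat \<Rightarrow> nat set \<Rightarrow> bool" where
  "nrt_anti_ideal m s J \<longleftrightarrow> (\<exists>I. nrt_ideal m s I \<and> J = {1..m * s} - I)"

text \<open>The ring structure of \<open>\<int>\<^sub>q\<close> plays no role for the NRT distance, so its elements are
  represented by the residues \<open>0, \<dots>, q - 1\<close>, and vectors by extensional functions; in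
  particular the space is a finite set.\<close>

definition nrt_space :: "nat \<Rightarrow> nat \<Rightarrow> nat \<Rightarrow> (nat \<Rightarrow> nat) set" where
  "nrt_space q m s = {1..m * s} \<rightarrow>\<^sub>E {0..<q}"

text \<open>\<open>nrt_ideal m s hull A\<close> is the intersection of all ideals containing \<open>A\<close>, that is, the
  smallest such ideal whenever \<open>A \<subseteq> {1..m * s}\<close>.\<close>

definition nrt_dist :: "nat \<Rightarrow> nat \<Rightarrow> (nat \<Rightarrow> nat) \<Rightarrow> (nat \<Rightarrow> nat) \<Rightarrow> nat" where
  "nrt_dist m s x y = card (nrt_ideal m s hull {i \<in> {1..m * s}. x i \<noteq> y i})"

definition nrt_covering :: "nat \<Rightarrow> nat \<Rightarrow> nat \<Rightarrow> nat \<Rightarrow> (nat \<Rightarrow> nat) set \<Rightarrow> bool" where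
  "nrt_covering q m s R C \<longleftrightarrow>
     C \<subseteq> nrt_space q m s \<and> (\<forall>x\<in>nrt_space q m s. \<exists>c\<in>C. nrt_dist m s x c \<le> R)"

definition nrt_K :: "nat \<Rightarrow> nat \<Rightarrow> nat \<Rightarrow> nat \<Rightarrow> nat" where
  "nrt_K q m s R = (LEAST n. \<exists>C. nrt_covering q m s R C \<and> card C = n)"

text \<open>An array with \<open>N\<close> rows is a function \<open>M\<close>, where \<open>M r c\<close> is the entry in row
  \<open>r < N\<close> and column \<open>c\<close>. A tuple over \<open>V\<close> indexed by the columns in \<open>J\<close> is an element
  of \<open>J \<rightarrow>\<^sub>E V\<close>.\<close>

definition covered_columns :: "'a set \<Rightarrow> nat \<Rightarrow> (nat \<Rightarrow> nat \<Rightarrow> 'a) \<Rightarrow> nat set \<Rightarrow> bool" where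
  "covered_columns V N M J \<longleftrightarrow> (\<forall>f\<in>J \<rightarrow>\<^sub>E V. \<exists>r<N. \<forall>c\<in>J. M r c = f c)"

definition is_OCA ::
  "nat \<Rightarrow> nat \<Rightarrow> nat \<Rightarrow> nat \<Rightarrow> nat \<Rightarrow> (nat \<Rightarrow> nat \<Rightarrow> nat) \<Rightarrow> bool" where
  "is_OCA N t m s v M \<longleftrightarrow>
     2 \<le> t \<and> t \<le> m * s \<and>
     (\<forall>r<N. \<forall>c\<in>{1..m * s}. M r c \<in> {0..<v}) \<and>
     (\<forall>J. nrt_anti_ideal m s J \<and> card J = t \<longrightarrow> covered_columns {0..<v} N M J)"

definition OCAN :: "nat \<Rightarrow> nat \<Rightarrow> nat \<Rightarrow> nat \<Rightarrow> nat" where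
  "OCAN t m s v = (LEAST N. 0 < N \<and> (\<exists>M. is_OCA N t m s v M))"

end

theory Submission
  imports Defs
begin

text \<open>Put \<open>t = k * s + j\<close>. Being within distance \<open>m * s - t\<close> amounts
  to agreeing on some anti-ideal with \<open>t\<close> elements
  (\<open>nrt_dist_le_of_agree\<close>, \<open>agree_of_nrt_dist_le\<close>). This gives the product
  bound \<open>nrt_K_mult_le\<close>: split every symbol below \<open>v * q\<close> into quotient
  and remainder modulo \<open>q\<close>; a code over \<open>q\<close> matches the remainders on some
  anti-ideal of size \<open>t\<close>, and a row of an ordered covering array matches the quotients
  there.

  It remains to find a cheap code over \<open>q\<close>. Matching on one fixed anti-ideal costs
  \<open>q ^ t\<close> words. The saving comes from three overlapping anti-ideals
  \<open>P \<union> X1 \<union> X2\<close>, \<open>P \<union> Y1 \<union> Y2\<close> and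
  \<open>P \<union> X1 \<union> Y1\<close>, where every part but \<open>P\<close> has
  \<open>k\<close> elements (\<open>crossed_code\<close>, placed in the poset by
  \<open>nrt_K_crossed_le\<close>). For each pattern on \<open>P\<close>, vectors vanishing on
  \<open>X1\<close> or on \<open>Y1\<close> need only \<open>q ^ k\<close> words together, and the
  others \<open>(q ^ k - 1)\<^sup>2\<close>. The sum is \<open>q ^ (2 * k) - (q ^ k - 1)\<close>;
  multiplied by the \<open>q ^ (k * (s - 2) + j)\<close> patterns on \<open>P\<close>, it is the
  bracket in the theorem.\<close>

section \<open>Ideals, and distance as agreement on anti-ideals\<close>

lemma nrt_block_index:
  assumes "a \<in> nrt_block s i"
  shows "(a - 1) div s = i"
  using assms by (intro div_nat_eqI) (auto simp: nrt_block_def algebra_simps)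

lemma nrt_block_subset: "i < m \<Longrightarrow> nrt_block s i \<subseteq> {1..m * s}"
  using mult_le_mono1[of "i + 1" m s] by (auto simp: nrt_block_def simp del: mult_Suc)

lemma nrt_le_carrier:
  assumes "nrt_le m s a b"
  shows "a \<in> {1..m * s}" "b \<in> {1..m * s}" "a \<le> b"
  using assms nrt_block_subset unfolding nrt_le_def by blast+

lemma nrt_ideal_carrier: "nrt_ideal m s {1..m * s}"
  unfolding nrt_ideal_def using nrt_le_carrier by blast

text \<open>Ideals are closed under intersection. The bound on \<open>D\<close> puts the whole
  carrier among the intersected ideals, which keeps the hull inside it.\<close>

lemma nrt_ideal_hull:
  assumes "D \<subseteq> {1..m * s}"
  shows "nrt_ideal m s (nrt_ideal m s hull D)"
proof -
  have "nrt_ideal m s hull D \<subseteq> {1..m * s}"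
    using assms nrt_ideal_carrier by (intro hull_minimal)
  moreover have "a \<in> nrt_ideal m s hull D"
    if "b \<in> nrt_ideal m s hull D" "nrt_le m s a b" for a b
  proof (unfold hull_def, rule InterI, drule CollectD)
    fix I assume I: "nrt_ideal m s I \<and> D \<subseteq> I"
    then have "b \<in> I" using hull_minimal[of D I "nrt_ideal m s"] that(1) by blast
    then show "a \<in> I" using I that(2) unfolding nrt_ideal_def by blast
  qed
  ultimately show ?thesis unfolding nrt_ideal_def[of m s "_ hull _"] by blast
qed

text \<open>The complement of \<open>J\<close> is an ideal containing every disagreement, hence also
  the ideal these generate.\<close>

lemma nrt_dist_le_of_agree:
  assumes J: "nrt_anti_ideal m s J" "card J = t" and agree: "\<And>i. i \<in> J \<Longrightarrow> x i = c i"
  shows "nrt_dist m s x c \<le> m * s - t"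
proof -
  obtain I where I: "nrt_ideal m s I" "J = {1..m * s} - I"
    using J(1) by (auto simp: nrt_anti_ideal_def)
  have sub: "I \<subseteq> {1..m * s}" using I(1) by (simp add: nrt_ideal_def)
  have fin: "finite I" using sub finite_subset by blast
  have "{i \<in> {1..m * s}. x i \<noteq> c i} \<subseteq> I" using I(2) agree by auto
  then have "nrt_ideal m s hull {i \<in> {1..m * s}. x i \<noteq> c i} \<subseteq> I"
    using I(1) by (rule hull_minimal)
  then have "nrt_dist m s x c \<le> card I"
    unfolding nrt_dist_def by (rule card_mono[OF fin])
  also have "card I = m * s - t"
    using card_Diff_subset[OF fin sub] card_mono[OF _ sub] J(2) I(2) by simp
  finally show ?thesis .
qed

text \<open>The order of the poset is contained in the numerical one, so adding the numerically
  least missing element again gives an ideal. Repeating this reaches every size up to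
  \<open>m * s\<close>.\<close>

lemma nrt_ideal_extend:
  assumes "nrt_ideal m s I" "card I \<le> n" "n \<le> m * s"
  shows "\<exists>I'. nrt_ideal m s I' \<and> I \<subseteq> I' \<and> card I' = n"
  using assms
proof (induction "n - card I" arbitrary: I)
  case 0
  then show ?case by auto
next
  case (Suc d)
  have sub: "I \<subseteq> {1..m * s}" using Suc.prems(1) by (simp add: nrt_ideal_def)
  have fin: "finite I" using sub finite_subset by blast
  have ne: "{1..m * s} - I \<noteq> {}"
  proof
    assume "{1..m * s} - I = {}"
    then have "I = {1..m * s}" using sub by auto
    then show False using Suc by simp
  qed
  define a where "a = Min ({1..m * s} - I)"
  have a: "a \<in> {1..m * s} - I" unfolding a_def using ne by (intro Min_in) auto
  have a_le: "a \<le> b" if "b \<in> {1..m * s} - I" for b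
    unfolding a_def using that by (intro Min_le) auto
  have "b \<in> insert a I" if "c \<in> insert a I" "nrt_le m s b c" for b c
  proof (cases "c \<in> I")
    case True
    then show ?thesis using that Suc.prems(1) by (auto simp: nrt_ideal_def)
  next
    case False
    then have "b \<le> a" "b \<in> {1..m * s}"
      using that nrt_le_carrier by auto
    then show ?thesis using a_le[of b] by auto
  qed
  then have ideal: "nrt_ideal m s (insert a I)"
    using sub a by (auto simp: nrt_ideal_def)
  have "card (insert a I) = Suc (card I)" using a fin by simp
  then show ?case using Suc.hyps(1)[OF _ ideal] Suc.hyps(2) Suc.prems by fastforce
qed

text \<open>Converse of \<open>nrt_dist_le_of_agree\<close>: the ideal generated by the
  disagreements may be too small, so it is enlarged to exactly \<open>m * s - t\<close> elements
  before taking the complement.\<close>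

lemma agree_of_nrt_dist_le:
  assumes "nrt_dist m s x c \<le> m * s - t" "t \<le> m * s"
  obtains J where "nrt_anti_ideal m s J" "card J = t" "\<And>i. i \<in> J \<Longrightarrow> x i = c i"
proof -
  define D where "D = {i \<in> {1..m * s}. x i \<noteq> c i}"
  have "nrt_ideal m s (nrt_ideal m s hull D)"
    by (rule nrt_ideal_hull) (auto simp: D_def)
  then obtain I where I: "nrt_ideal m s I" "nrt_ideal m s hull D \<subseteq> I" "card I = m * s - t"
    using nrt_ideal_extend[of m s "nrt_ideal m s hull D" "m * s - t"] assms
    by (auto simp: nrt_dist_def D_def)
  have sub: "I \<subseteq> {1..m * s}" using I(1) by (simp add: nrt_ideal_def)
  show ?thesis
  proof
    show "nrt_anti_ideal m s ({1..m * s} - I)" using I(1) by (auto simp: nrt_anti_ideal_def)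
    show "card ({1..m * s} - I) = t"
      using card_Diff_subset[OF finite_subset[OF sub] sub] I(3) assms(2) by simp
    show "x i = c i" if "i \<in> {1..m * s} - I" for i
      using that I(2) hull_subset[of D "nrt_ideal m s"] by (auto simp: D_def)
  qed
qed

section \<open>Attainment of the two minima\<close>

lemma nrt_K_le:
  assumes "nrt_covering q m s R C"
  shows "nrt_K q m s R \<le> card C"
  unfolding nrt_K_def using assms by (intro Least_le) blast

lemma finite_nrt_space: "finite (nrt_space q m s)"
  unfolding nrt_space_def by (intro finite_PiE) auto

text \<open>The whole space is a covering, since every vector has distance 0 from itself; so the
  \<open>LEAST\<close> ranges over a nonempty set.\<close>

lemma nrt_K_attained: "\<exists>C. nrt_covering q m s R C \<and> card C = nrt_K q m s R"
  unfolding nrt_K_def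
proof (rule LeastI_ex)
  have "nrt_dist m s x x \<le> R" for x
  proof -
    have "nrt_ideal m s {}" by (simp add: nrt_ideal_def)
    then have "nrt_ideal m s hull {} = {}"
      using hull_minimal[of "{}" "{}" "nrt_ideal m s"] by simp
    then show ?thesis by (simp add: nrt_dist_def)
  qed
  then have "nrt_covering q m s R (nrt_space q m s)"
    by (auto simp: nrt_covering_def)
  then show "\<exists>n C. nrt_covering q m s R C \<and> card C = n" by blast
qed

text \<open>The \<open>LEAST\<close> needs at least one array: listing all vectors over
  \<open>v\<close> as rows covers every set of columns.\<close>

lemma OCAN_attained:
  assumes "2 \<le> t" "t \<le> m * s" "0 < v"
  shows "\<exists>M. is_OCA (OCAN t m s v) t m s v M"
proof -
  define S where "S = nrt_space v m s"
  have fin: "finite S" by (simp add: S_def finite_nrt_space)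
  obtain g where g: "bij_betw g {0..<card S} S"
    using ex_bij_betw_nat_finite[OF fin] by blast
  have "(\<lambda>i\<in>{1..m * s}. 0) \<in> S" using assms by (auto simp: S_def nrt_space_def)
  then have pos: "0 < card S" using fin by (auto simp: card_gt_0_iff)
  have "is_OCA (card S) t m s v g"
    unfolding is_OCA_def
  proof (intro conjI allI impI ballI)
    fix r c assume "r < card S" "c \<in> {1..m * s}"
    moreover from this g have "g r \<in> S" by (auto simp: bij_betw_def)
    ultimately show "g r c \<in> {0..<v}" by (auto simp: S_def nrt_space_def)
  next
    fix J assume J: "nrt_anti_ideal m s J \<and> card J = t"
    then have sub: "J \<subseteq> {1..m * s}" by (auto simp: nrt_anti_ideal_def)
    show "covered_columns {0..<v} (card S) g J"
      unfolding covered_columns_def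
    proof
      fix f assume f: "f \<in> J \<rightarrow>\<^sub>E {0..<v}"
      \<comment> \<open>The tuple \<open>f\<close> is padded with 0, a legal symbol because
        \<open>0 < v\<close>, to a full vector and hence a row.\<close>
      define x where "x = (\<lambda>i\<in>{1..m * s}. if i \<in> J then f i else 0)"
      have "x \<in> S" using f assms by (auto simp: x_def S_def nrt_space_def)
      then have "x \<in> g ` {0..<card S}" using g by (simp add: bij_betw_def)
      then obtain r where "r < card S" "g r = x" by auto
      then show "\<exists>r<card S. \<forall>c\<in>J. g r c = f c" using sub by (intro exI[of _ r]) (auto simp: x_def)
    qed
  qed (use assms in auto)
  then have "\<exists>N. 0 < N \<and> (\<exists>M. is_OCA N t m s v M)" using pos by blast
  from LeastI_ex[OF this] show ?thesis by (simp add: OCAN_def)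
qed

section \<open>Product of a covering code with an ordered covering array\<close>

text \<open>Symbols over \<open>v * q\<close> are split as \<open>a * q + b\<close>: a code over \<open>q\<close> handles the \<open>b\<close>-part and
  thereby selects an anti-ideal, on which some row of the array matches the \<open>a\<close>-part.\<close>

theorem nrt_K_mult_le:
  assumes "2 \<le> t" "t \<le> m * s" "0 < v" "0 < q"
  shows "nrt_K (v * q) m s (m * s - t) \<le> OCAN t m s v * nrt_K q m s (m * s - t)"
proof -
  define N where "N = OCAN t m s v"
  obtain M where M: "is_OCA N t m s v M" using OCAN_attained assms unfolding N_def by blast
  obtain C where C: "nrt_covering q m s (m * s - t) C" "card C = nrt_K q m s (m * s - t)"
    using nrt_K_attained by blast
  have C_sub: "C \<subseteq> nrt_space q m s" using C(1) by (simp add: nrt_covering_def)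
  have fin: "finite C" using C_sub finite_nrt_space finite_subset by blast
  define w where "w = (\<lambda>(r, c). \<lambda>i\<in>{1..m * s}. M r i * q + c i)"
  have "nrt_covering (v * q) m s (m * s - t) (w ` ({..<N} \<times> C))"
    unfolding nrt_covering_def
  proof (intro conjI ballI)
    show "w ` ({..<N} \<times> C) \<subseteq> nrt_space (v * q) m s"
    proof clarify
      fix r c assume r: "r < N" and c: "c \<in> C"
      have "M r i * q + c i < v * q" if i: "i \<in> {1..m * s}" for i
      proof -
        have "M r i < v" using M r i unfolding is_OCA_def by (meson atLeastLessThan_iff)
        then have "M r i + 1 \<le> v" by simp
        then have "(M r i + 1) * q \<le> v * q" by (rule mult_le_mono1)
        moreover have "c \<in> nrt_space q m s" using c C_sub by blast
        then have "c i < q" using i by (auto simp: nrt_space_def)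
        ultimately show ?thesis by simp
      qed
      then show "w (r, c) \<in> nrt_space (v * q) m s" by (auto simp: w_def nrt_space_def)
    qed
  next
    fix x assume x: "x \<in> nrt_space (v * q) m s"
    define b where "b = (\<lambda>i\<in>{1..m * s}. x i mod q)"
    have "b \<in> nrt_space q m s" using assms by (auto simp: b_def nrt_space_def)
    then obtain c where c: "c \<in> C" "nrt_dist m s b c \<le> m * s - t"
      using C(1) by (auto simp: nrt_covering_def)
    obtain J where J: "nrt_anti_ideal m s J" "card J = t" "\<And>i. i \<in> J \<Longrightarrow> b i = c i"
      using agree_of_nrt_dist_le[OF c(2) assms(2)] by blast
    have sub: "J \<subseteq> {1..m * s}" using J(1) by (auto simp: nrt_anti_ideal_def)
    \<comment> \<open>The row is chosen only after the remainders have fixed \<open>c\<close> and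
      thereby \<open>J\<close>; this is why \<open>J\<close> has to be covered whichever anti-ideal
      of size \<open>t\<close> it is.\<close>
    have "(\<lambda>i\<in>J. x i div q) \<in> J \<rightarrow>\<^sub>E {0..<v}"
      using x sub by (auto simp: nrt_space_def PiE_iff less_mult_imp_div_less subset_iff)
    moreover have "covered_columns {0..<v} N M J" using M J by (auto simp: is_OCA_def)
    ultimately obtain r where r: "r < N" "\<forall>i\<in>J. M r i = (\<lambda>i\<in>J. x i div q) i"
      unfolding covered_columns_def by blast
    have "x i = w (r, c) i" if "i \<in> J" for i
    proof -
      have "c i = x i mod q" using J(3)[OF that] that sub by (auto simp: b_def)
      then show ?thesis using that r(2) sub by (auto simp: w_def)
    qed
    then have "nrt_dist m s x (w (r, c)) \<le> m * s - t" by (rule nrt_dist_le_of_agree[OF J(1,2)])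
    then show "\<exists>c\<in>w ` ({..<N} \<times> C). nrt_dist m s x c \<le> m * s - t" using r(1) c(1) by blast
  qed
  then have "nrt_K (v * q) m s (m * s - t) \<le> card (w ` ({..<N} \<times> C))" by (rule nrt_K_le)
  also have "\<dots> \<le> card ({..<N} \<times> C)" using fin by (intro card_image_le) auto
  finally show ?thesis using C(2) by (simp add: N_def card_cartesian_product)
qed

section \<open>A covering by three overlapping sets of coordinates\<close>

text \<open>The columns in \<open>X2\<close> and \<open>Y2\<close> share their entries, so a single family of \<open>q ^ k\<close> words (for
  each pattern on \<open>P\<close>) serves the vectors vanishing on \<open>X1\<close> and those vanishing on \<open>Y1\<close>; the other
  vectors are matched on \<open>P \<union> X1 \<union> Y1\<close>, with a nonzero pattern on \<open>X1\<close> and on \<open>Y1\<close>.\<close>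

lemma crossed_code:
  fixes q k :: nat
  assumes q: "0 < q" and fin: "finite A"
    and sub: "P \<subseteq> A" "X1 \<subseteq> A" "X2 \<subseteq> A" "Y1 \<subseteq> A" "Y2 \<subseteq> A"
    and disj: "P \<inter> X1 = {}" "P \<inter> X2 = {}" "P \<inter> Y1 = {}" "P \<inter> Y2 = {}"
      "X1 \<inter> X2 = {}" "X1 \<inter> Y1 = {}" "X1 \<inter> Y2 = {}" "X2 \<inter> Y1 = {}" "X2 \<inter> Y2 = {}" "Y1 \<inter> Y2 = {}"
    and card: "card X1 = k" "card X2 = k" "card Y1 = k" "card Y2 = k"
  shows "\<exists>D \<subseteq> A \<rightarrow>\<^sub>E {0..<q}. card D \<le> q ^ card P * ((q ^ k - 1)\<^sup>2 + q ^ k) \<and>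
    (\<forall>x \<in> A \<rightarrow>\<^sub>E {0..<q}. \<exists>c\<in>D. \<exists>J \<in> {P \<union> X1 \<union> X2, P \<union> Y1 \<union> Y2, P \<union> X1 \<union> Y1}. \<forall>i\<in>J. x i = c i)"
proof -
  have finS: "finite P" "finite X1" "finite X2" "finite Y1" "finite Y2"
    using sub fin finite_subset by blast+
  obtain \<sigma> where \<sigma>: "bij_betw \<sigma> Y2 X2"
    using finite_same_card_bij[of Y2 X2] finS card by auto
  have \<sigma>_in: "\<sigma> i \<in> X2" if "i \<in> Y2" for i using \<sigma> that by (auto simp: bij_betw_def)
  define E where "E = (\<lambda>S :: 'a set. S \<rightarrow>\<^sub>E {0..<q})"
  define E' where "E' = (\<lambda>S. E S - {\<lambda>i\<in>S. 0})"
  \<comment> \<open>Words for the generic vectors: free on \<open>P\<close>, nonzero patterns on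
    \<open>X1\<close> and \<open>Y1\<close>, and 0 elsewhere.\<close>
  define f where "f = (\<lambda>(p, a, b). \<lambda>i\<in>A. if i \<in> P then p i else if i \<in> X1 then a i
    else if i \<in> Y1 then b i else (0 :: nat))"
  \<comment> \<open>These words are 0 on both \<open>X1\<close> and \<open>Y1\<close>, and
    \<open>\<sigma>\<close> copies the entries on \<open>X2\<close> to \<open>Y2\<close>; so one
    word can serve either special case.\<close>
  define g where "g = (\<lambda>(p, u). \<lambda>i\<in>A. if i \<in> P then p i else if i \<in> X2 then u i
    else if i \<in> Y2 then u (\<sigma> i) else (0 :: nat))"
  define F where "F = f ` (E P \<times> E' X1 \<times> E' Y1)"
  define G where "G = g ` (E P \<times> E X2)"
  have finE: "finite (E S)" "finite (E' S)" if "finite S" for S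
    using that by (auto simp: E_def E'_def intro: finite_PiE)
  have cardE: "card (E S) = q ^ card S" if "finite S" for S
    using that by (simp add: E_def card_PiE)
  have cardE': "card (E' S) = q ^ card S - 1" if "finite S" for S
    using that q cardE[OF that] by (simp add: E'_def E_def card_Diff_singleton)
  have "card (F \<union> G) \<le> card F + card G" by (rule card_Un_le)
  also have "card F \<le> card (E P \<times> E' X1 \<times> E' Y1)"
    unfolding F_def using finS finE by (intro card_image_le) auto
  also have "card G \<le> card (E P \<times> E X2)"
    unfolding G_def using finS finE by (intro card_image_le) auto
  finally have cardD: "card (F \<union> G) \<le> q ^ card P * ((q ^ k - 1)\<^sup>2 + q ^ k)"
    using finS card by (simp add: card_cartesian_product cardE cardE' power2_eq_square algebra_simps)
  have "F \<subseteq> A \<rightarrow>\<^sub>E {0..<q}"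
    using q by (auto simp: F_def f_def E_def E'_def PiE_iff)
  moreover have "G \<subseteq> A \<rightarrow>\<^sub>E {0..<q}"
    using q \<sigma>_in by (auto simp: G_def g_def E_def PiE_iff)
  moreover have "\<exists>c\<in>F \<union> G. \<exists>J \<in> {P \<union> X1 \<union> X2, P \<union> Y1 \<union> Y2, P \<union> X1 \<union> Y1}. \<forall>i\<in>J. x i = c i"
    if x: "x \<in> A \<rightarrow>\<^sub>E {0..<q}" for x
  proof -
    have rE: "restrict x S \<in> E S" if "S \<subseteq> A" for S
      using x that by (auto simp: E_def PiE_iff)
    consider "\<forall>i\<in>X1. x i = 0" | "\<forall>i\<in>Y1. x i = 0"
      | "\<not> (\<forall>i\<in>X1. x i = 0)" "\<not> (\<forall>i\<in>Y1. x i = 0)" by blast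
    then show ?thesis
    proof cases
      case 1
      define c where "c = g (restrict x P, restrict x X2)"
      have "c \<in> G" using rE sub by (auto simp: c_def G_def)
      moreover have "x i = c i" if "i \<in> P \<union> X1 \<union> X2" for i
        using that 1 sub disj by (auto simp: c_def g_def)
      ultimately show ?thesis by blast
    next
      case 2
      \<comment> \<open>The entries of \<open>x\<close> on \<open>Y2\<close> are carried back to
        \<open>X2\<close>, so that the copying in \<open>g\<close> reproduces them on
        \<open>Y2\<close>.\<close>
      define u where "u = (\<lambda>i\<in>X2. x (inv_into Y2 \<sigma> i))"
      define c where "c = g (restrict x P, u)"
      have inv: "inv_into Y2 \<sigma> i \<in> Y2" if "i \<in> X2" for i
        using \<sigma> that by (metis bij_betw_def inv_into_into)
      have "u \<in> E X2" using x inv sub by (auto simp: u_def E_def PiE_iff subset_iff)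
      then have "c \<in> G" using rE sub by (auto simp: c_def G_def)
      moreover have "x i = c i" if "i \<in> P \<union> Y1 \<union> Y2" for i
      proof -
        have "u (\<sigma> i) = x i" if "i \<in> Y2" for i
          using \<sigma> that \<sigma>_in by (auto simp: u_def bij_betw_def)
        then show ?thesis using that 2 sub disj by (auto simp: c_def g_def)
      qed
      ultimately show ?thesis by blast
    next
      case 3
      define c where "c = f (restrict x P, restrict x X1, restrict x Y1)"
      have "restrict x S \<noteq> (\<lambda>i\<in>S. 0)" if "\<not> (\<forall>i\<in>S. x i = 0)" for S
        using that by (metis restrict_apply')
      then have "c \<in> F" using rE sub 3 by (auto simp: c_def F_def E'_def)
      moreover have "x i = c i" if "i \<in> P \<union> X1 \<union> Y1" for i
        using that sub disj by (auto simp: c_def f_def)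
      ultimately show ?thesis by blast
    qed
  qed
  ultimately show ?thesis using cardD by (intro exI[of _ "F \<union> G"]) auto
qed

section \<open>Placing the sets in the NRT poset\<close>

text \<open>The pair \<open>(i, d)\<close> stands for the element of block \<open>i\<close> at depth \<open>d\<close> below its maximum.\<close>

definition nrt_elem :: "nat \<Rightarrow> nat \<times> nat \<Rightarrow> nat" where
  "nrt_elem s = (\<lambda>(i, d). (i + 1) * s - d)"

lemma nrt_elem_in_block: "d < s \<Longrightarrow> nrt_elem s (i, d) \<in> nrt_block s i"
  by (auto simp: nrt_elem_def nrt_block_def)

text \<open>The depth bounds keep each element inside its own block, whose index is recovered by
  division.\<close>

lemma nrt_elem_eq_iff:
  assumes "d < s" "d' < s"
  shows "nrt_elem s (i, d) = nrt_elem s (i', d') \<longleftrightarrow> i = i' \<and> d = d'"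
proof
  assume eq: "nrt_elem s (i, d) = nrt_elem s (i', d')"
  then have "i = i'"
    using nrt_block_index nrt_elem_in_block assms by metis
  then show "i = i' \<and> d = d'" using eq assms by (auto simp: nrt_elem_def)
qed simp

lemma inj_on_nrt_elem: "inj_on (nrt_elem s) (B \<times> {..<s})"
  by (rule inj_onI) (auto simp: nrt_elem_eq_iff)

lemma nrt_elem_image_subset:
  assumes "S \<subseteq> {..<m} \<times> {..<s}"
  shows "nrt_elem s ` S \<subseteq> {1..m * s}"
proof clarify
  fix i d assume "(i, d) \<in> S"
  then have "i < m" "d < s" using assms by auto
  then show "nrt_elem s (i, d) \<in> {1..m * s}"
    using nrt_elem_in_block nrt_block_subset by blast
qed

text \<open>Anti-ideals are the upward closed sets, and moving up a chain means decreasing the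
  depth.\<close>

lemma nrt_anti_ideal_image:
  assumes S: "S \<subseteq> {..<m} \<times> {..<s}"
    and closed: "\<And>i d d'. (i, d) \<in> S \<Longrightarrow> d' \<le> d \<Longrightarrow> (i, d') \<in> S"
  shows "nrt_anti_ideal m s (nrt_elem s ` S)"
proof -
  have sub: "nrt_elem s ` S \<subseteq> {1..m * s}" using S by (rule nrt_elem_image_subset)
  have "b \<in> nrt_elem s ` S" if a: "a \<in> nrt_elem s ` S" and le: "nrt_le m s a b" for a b
  proof -
    obtain i d where id: "(i, d) \<in> S" "a = nrt_elem s (i, d)" using a by auto
    then have d: "d < s" using S by auto
    obtain i' where i': "a \<in> nrt_block s i'" "b \<in> nrt_block s i'" "a \<le> b"
      using le by (auto simp: nrt_le_def)
    then have "i' = i" using nrt_block_index nrt_elem_in_block d id by metis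
    \<comment> \<open>The depth of \<open>b\<close> is \<open>(i + 1) * s - b\<close>, at most that
      of \<open>a\<close> because \<open>a \<le> b\<close>.\<close>
    then have "b = nrt_elem s (i, (i + 1) * s - b)" "(i + 1) * s - b \<le> d"
      using i' id d by (auto simp: nrt_elem_def nrt_block_def)
    then show ?thesis using closed[OF id(1)] by (metis imageI)
  qed
  then have "nrt_ideal m s ({1..m * s} - nrt_elem s ` S)"
    unfolding nrt_ideal_def using nrt_le_carrier by blast
  then show ?thesis using sub unfolding nrt_anti_ideal_def by blast
qed

lemma nrt_K_crossed_le:
  assumes q: "0 < q" and s: "2 \<le> s" and j: "j \<le> s" "j = 0 \<or> 2 * k < m" and m: "2 * k \<le> m"
  shows "nrt_K q m s (m * s - (k * s + j)) \<le> q ^ (k * (s - 2) + j) * ((q ^ k - 1)\<^sup>2 + q ^ k)"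
proof -
  let ?e = "\<lambda>S. nrt_elem s ` S"
  \<comment> \<open>In the first \<open>k\<close> blocks, \<open>X2\<close> is the row of minima,
    \<open>X1\<close> the row just above and \<open>P\<close> everything higher. In the next
    \<open>k\<close> blocks, \<open>Y1\<close> is the row of maxima and \<open>Y2\<close> the row
    just below. The top \<open>j\<close> elements of block \<open>2 * k\<close> adjust the size;
    that block is available unless \<open>j = 0\<close>.\<close>
  define P where "P = {..<k} \<times> {..<s - 2} \<union> {2 * k} \<times> {..<j}"
  define X1 where "X1 = {..<k} \<times> {s - 2}"
  define X2 where "X2 = {..<k} \<times> {s - 1}"
  define Y1 where "Y1 = {k..<2 * k} \<times> {0 :: nat}"
  define Y2 where "Y2 = {k..<2 * k} \<times> {1 :: nat}"
  note defs = P_def X1_def X2_def Y1_def Y2_def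
  let ?U = "{..<m} \<times> {..<s}"
  have sub: "P \<subseteq> ?U" "X1 \<subseteq> ?U" "X2 \<subseteq> ?U" "Y1 \<subseteq> ?U" "Y2 \<subseteq> ?U"
    using assms by (auto simp: defs)
  have fin: "finite P" "finite X1" "finite X2" "finite Y1" "finite Y2"
    by (auto simp: defs)
  have disj: "P \<inter> X1 = {}" "P \<inter> X2 = {}" "P \<inter> Y1 = {}" "P \<inter> Y2 = {}"
    "X1 \<inter> X2 = {}" "X1 \<inter> Y1 = {}" "X1 \<inter> Y2 = {}" "X2 \<inter> Y1 = {}" "X2 \<inter> Y2 = {}" "Y1 \<inter> Y2 = {}"
    using s by (auto simp: defs)
  have card: "card X1 = k" "card X2 = k" "card Y1 = k" "card Y2 = k"
    by (auto simp: defs card_cartesian_product)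
  have "card P = card ({..<k} \<times> {..<s - 2}) + card ({2 * k} \<times> {..<j})"
    unfolding P_def by (intro card_Un_disjoint) auto
  then have cardP: "card P = k * (s - 2) + j" by (simp add: card_cartesian_product)
  have inj: "inj_on (nrt_elem s) ?U" by (rule inj_on_nrt_elem)
  have card_e: "card (?e S) = card S" if "S \<subseteq> ?U" for S
    using that inj by (intro card_image) (rule inj_on_subset)
  have disj_e: "?e S \<inter> ?e T = {}" if "S \<subseteq> ?U" "T \<subseteq> ?U" "S \<inter> T = {}" for S T
    using inj_on_image_Int[OF inj that(1,2)] that(3) by simp
  have sub_e: "?e S \<subseteq> {1..m * s}" if "S \<subseteq> ?U" for S
    using that by (rule nrt_elem_image_subset)
  obtain D where D: "D \<subseteq> {1..m * s} \<rightarrow>\<^sub>E {0..<q}"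
      "card D \<le> q ^ card (?e P) * ((q ^ k - 1)\<^sup>2 + q ^ k)"
    and D_cover: "\<And>x. x \<in> {1..m * s} \<rightarrow>\<^sub>E {0..<q} \<Longrightarrow> \<exists>c\<in>D.
      \<exists>J \<in> {?e P \<union> ?e X1 \<union> ?e X2, ?e P \<union> ?e Y1 \<union> ?e Y2, ?e P \<union> ?e X1 \<union> ?e Y1}. \<forall>i\<in>J. x i = c i"
    using crossed_code[of q "{1..m * s}" "?e P" "?e X1" "?e X2" "?e Y1" "?e Y2" k]
      q sub_e[OF sub(1)] sub_e[OF sub(2)] sub_e[OF sub(3)] sub_e[OF sub(4)] sub_e[OF sub(5)]
    by (auto simp: card_e disj_e sub disj card)
  have anti: "nrt_anti_ideal m s (?e (P \<union> S \<union> T)) \<and> card (?e (P \<union> S \<union> T)) = k * s + j"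
    if ST: "(S, T) \<in> {(X1, X2), (Y1, Y2), (X1, Y1)}" for S T
  proof
    have "P \<union> S \<union> T \<subseteq> ?U" using ST sub by auto
    then show "nrt_anti_ideal m s (?e (P \<union> S \<union> T))"
    proof (rule nrt_anti_ideal_image)
      \<comment> \<open>Above \<open>X1\<close> in its blocks lies only \<open>P\<close>, above
        \<open>X2\<close> only \<open>X1\<close> and \<open>P\<close>, and above \<open>Y2\<close>
        only \<open>Y1\<close>.\<close>
      show "(i, d') \<in> P \<union> S \<union> T" if "(i, d) \<in> P \<union> S \<union> T" "d' \<le> d" for i d d'
        using ST that s by (auto simp: defs)
    qed
    have "card (P \<union> S \<union> T) = card P + card S + card T"
      using ST disj fin by (auto simp: card_Un_disjoint Int_Un_distrib2)
    moreover have "k * (s - 2) + 2 * k = k * s"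
      using s by (auto simp: le_iff_add algebra_simps)
    ultimately show "card (?e (P \<union> S \<union> T)) = k * s + j"
      using ST card cardP card_e[OF \<open>P \<union> S \<union> T \<subseteq> ?U\<close>] by auto
  qed
  have "nrt_covering q m s (m * s - (k * s + j)) D"
    unfolding nrt_covering_def nrt_space_def
  proof (intro conjI ballI D(1))
    fix x assume "x \<in> {1..m * s} \<rightarrow>\<^sub>E {0..<q}"
    then obtain c S T where c: "c \<in> D" and ST: "(S, T) \<in> {(X1, X2), (Y1, Y2), (X1, Y1)}"
      and agree: "\<forall>i \<in> ?e (P \<union> S \<union> T). x i = c i"
      using D_cover[of x] by (fastforce simp: image_Un)
    have "nrt_dist m s x c \<le> m * s - (k * s + j)"
      using anti[OF ST] agree by (intro nrt_dist_le_of_agree[of m s "?e (P \<union> S \<union> T)"]) blast+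
    then show "\<exists>c\<in>D. nrt_dist m s x c \<le> m * s - (k * s + j)" using c by blast
  qed
  then have "nrt_K q m s (m * s - (k * s + j)) \<le> card D" by (rule nrt_K_le)
  then show ?thesis using D(2) card_e[OF sub(1)] cardP by simp
qed

section \<open>Combining the two bounds\<close>

text \<open>Both claims are instances, with \<open>m = 2 * k + 1\<close> or with
  \<open>m = 2 * k\<close> and \<open>j = 0\<close>. The bound is stated in the integers so that the
  difference is not truncated.\<close>

lemma nrt_K_le_OCAN:
  fixes v q s k j m :: nat
  assumes "0 < v" "0 < q" "2 \<le> s" "1 \<le> k" "j \<le> s" "j = 0 \<or> 2 * k < m" "2 * k \<le> m"
  shows "int (nrt_K (v * q) m s (m * s - (k * s + j)))
    \<le> int (OCAN (k * s + j) m s v) *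
      (int q ^ (k * s + j) - int q ^ (k * (s - 2) + j) * (int q ^ k - 1))"
proof -
  let ?t = "k * s + j"
  have t: "2 \<le> ?t" using mult_le_mono[of 1 k 2 s] assms by simp
  have "?t \<le> m * s"
  proof (cases "j = 0")
    case True
    then show ?thesis using assms by simp
  next
    case False
    then have "(k + 1) * s \<le> m * s" using assms by (intro mult_le_mono1) auto
    then show ?thesis using assms by simp
  qed
  then have "nrt_K (v * q) m s (m * s - ?t) \<le> OCAN ?t m s v * nrt_K q m s (m * s - ?t)"
    using t assms by (intro nrt_K_mult_le) auto
  also have "\<dots> \<le> OCAN ?t m s v * (q ^ (k * (s - 2) + j) * ((q ^ k - 1)\<^sup>2 + q ^ k))"
    using assms by (intro mult_le_mono2 nrt_K_crossed_le) auto
  finally have "int (nrt_K (v * q) m s (m * s - ?t))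
      \<le> int (OCAN ?t m s v * (q ^ (k * (s - 2) + j) * ((q ^ k - 1)\<^sup>2 + q ^ k)))"
    by (simp only: of_nat_le_iff)
  also have "\<dots> = int (OCAN ?t m s v) *
      (int q ^ (k * (s - 2) + j) * ((int q ^ k - 1)\<^sup>2 + int q ^ k))"
    using assms by (simp add: of_nat_diff)
  \<comment> \<open>With \<open>a = q ^ k\<close> this is
    \<open>(a - 1)\<^sup>2 + a = a\<^sup>2 - (a - 1)\<close>, where \<open>a\<^sup>2\<close>
    supplies the \<open>2 * k\<close> missing factors of \<open>q ^ (k * s + j)\<close>.\<close>
  also have "int q ^ (k * (s - 2) + j) * ((int q ^ k - 1)\<^sup>2 + int q ^ k)
      = int q ^ ?t - int q ^ (k * (s - 2) + j) * (int q ^ k - 1)"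
  proof -
    have "k * (s - 2) + k * 2 = k * s"
      using assms by (metis add_mult_distrib2 le_add_diff_inverse2)
    then have "k * (s - 2) + j + 2 * k = ?t" by simp
    then have "int q ^ ?t = int q ^ (k * (s - 2) + j) * (int q ^ k)\<^sup>2"
      by (metis power_add power_mult mult.commute)
    then show ?thesis by (simp add: power2_eq_square algebra_simps)
  qed
  finally show ?thesis .
qed

theorem corollary17:
  fixes v q s k :: nat
  assumes "v \<ge> 2" and "q \<ge> 2" and "s \<ge> 3" and "k \<ge> 1"
  shows "(\<forall>j\<in>{0..s}.
            int (nrt_K (v * q) (2 * k + 1) s ((k + 1) * s - j))
              \<le> int (OCAN (k * s + j) (2 * k + 1) s v) *
                (int q ^ (k * s + j) - int q ^ (k * (s - 2) + j) * (int q ^ k - 1))) \<and>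
         int (nrt_K (v * q) (2 * k) s (k * s))
           \<le> int (OCAN (k * s) (2 * k) s v) *
             (int q ^ (k * s) - int q ^ (k * (s - 2)) * (int q ^ k - 1))"
proof (intro conjI ballI)
  fix j assume "j \<in> {0..s}"
  \<comment> \<open>This puts the radius into the form \<open>m * s - t\<close> with
    \<open>m = 2 * k + 1\<close>.\<close>
  moreover have "(k + 1) * s - j = (2 * k + 1) * s - (k * s + j)"
    by (simp add: algebra_simps)
  ultimately show "int (nrt_K (v * q) (2 * k + 1) s ((k + 1) * s - j))
      \<le> int (OCAN (k * s + j) (2 * k + 1) s v) *
        (int q ^ (k * s + j) - int q ^ (k * (s - 2) + j) * (int q ^ k - 1))"
    using nrt_K_le_OCAN[of v q s k j "2 * k + 1"] assms by simp
next
  show "int (nrt_K (v * q) (2 * k) s (k * s))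
      \<le> int (OCAN (k * s) (2 * k) s v) *
        (int q ^ (k * s) - int q ^ (k * (s - 2)) * (int q ^ k - 1))"
    using nrt_K_le_OCAN[of v q s k 0 "2 * k"] assms by simp
qed

end
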